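(* Let $G\in\mathrm{Mat}_{k\times n}(\mathbb{Z})$ have no zero column, with lcm period $\rho_0$, and let $m\in\{1,\dots,\rho_0\}$. For every $s\in\{0,1,\dots,r(E)\}$ there exists $i\in\{0,\dots,n\}$ with $\deg f_i^m(t)=s$. Moreover, for every $s\in\{1,\dots,r(E)\}$, $$\min\{i\in\{0,\dots,n\}\mid \deg f_i^m(t)=s-1\}<\min\{i\in\{0,\dots,n\}\mid \deg f_i^m(t)=s\}.$$
   Context: $E=\{1,\dots,n\}$. For nonempty $J\subseteq E$, $r(J)$ is the rank of the submatrix $G_J$ of columns indexed by $J$ and $e_{1,J}\mid\cdots\mid e_{r(J),J}$ its elementary divisors; $r(\emptyset)=0$; empty products equal $1$. $\rho_0:=\mathrm{lcm}(e_{r(J),J}\mid\emptyset\ne J\subseteq E)$. For $m\in\{1,\dots,\rho_0\}$ and $i\in\{0,\dots,n\}$, $$f_i^m(t):=\sum_{J\subseteq E,\ |J|=n-i}\ \sum_{K:\,J\subseteq K\subseteq E}(-1)^{|K|-|J|}\frac{\prod_{\ell=1}^{r(K)}\gcd(m,e_{\ell,K})}{\prod_{\ell=1}^{r(E)}\gcd(m,e_{\ell,E})}\,t^{r(E)-r(K)}\in\mathbb{Q}[t].$$ (For $q\equiv m\pmod{\rho_0}$, $f_i^m(q)$ equals the number of codewords of weight $i$ in $\{uG\mid u\in(\mathbb{Z}/q\mathbb{Z})^k\}$.) *)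

theory Defs
  imports
    "Jordan_Normal_Form.DL_Rank"
    "Jordan_Normal_Form.DL_Submatrix"
    "HOL-Computational_Algebra.Polynomial"
begin

text \<open>The ground set \<open>E = {1, \<dots>, n}\<close> of columns of \<open>G\<close> is rendered with the 0-based
  column indices of the matrix library.\<close>

abbreviation ground_set :: "int mat \<Rightarrow> nat set" where
  "ground_set G \<equiv> {0..<dim_col G}"

abbreviation columns_of :: "int mat \<Rightarrow> nat set \<Rightarrow> int mat" where
  "columns_of G J \<equiv> submatrix G UNIV J"

definition int_rank :: "int mat \<Rightarrow> nat" where
  "int_rank A = vec_space.rank (dim_row A) (map_mat rat_of_int A)"

text \<open>\<open>smith_form A es\<close>: the integer matrix \<open>A\<close> is equivalent, via matrices invertible over
  the integers, to the (rectangular) diagonal matrix with diagonal \<open>es\<close> followed by zeros,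
  where the entries of \<open>es\<close> are positive and each divides all later ones.\<close>

definition smith_form :: "int mat \<Rightarrow> nat list \<Rightarrow> bool" where
  "smith_form A es \<longleftrightarrow>
     length es \<le> min (dim_row A) (dim_col A) \<and>
     (\<forall>e\<in>set es. e > 0) \<and> sorted_wrt (dvd) es \<and>
     (\<exists>P Q. P \<in> carrier_mat (dim_row A) (dim_row A) \<and> invertible_mat P \<and>
            Q \<in> carrier_mat (dim_col A) (dim_col A) \<and> invertible_mat Q \<and>
            P * A * Q = mat (dim_row A) (dim_col A)
              (\<lambda>(i, j). if i = j \<and> i < length es then int (es ! i) else 0))"

definition elementary_divisors :: "int mat \<Rightarrow> nat list" where
  "elementary_divisors A = (THE es. smith_form A es)"

definition col_rank :: "int mat \<Rightarrow> nat set \<Rightarrow> nat" where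
  "col_rank G J = int_rank (columns_of G J)"

text \<open>\<open>col_edivisor G l J\<close> is the elementary divisor \<open>e\<^bsub>l,J\<^esub>\<close>, with \<open>l\<close> ranging over
  \<open>1, \<dots>, r(J)\<close> (lists are indexed from 0).\<close>

definition col_edivisor :: "int mat \<Rightarrow> nat \<Rightarrow> nat set \<Rightarrow> nat" where
  "col_edivisor G l J = elementary_divisors (columns_of G J) ! (l - 1)"

text \<open>Meaningful when \<open>G\<close> has no zero column, so that \<open>r(J) \<ge> 1\<close> for every nonempty \<open>J\<close>.\<close>

definition lcm_period :: "int mat \<Rightarrow> nat" where
  "lcm_period G = Lcm {col_edivisor G (col_rank G J) J | J. J \<noteq> {} \<and> J \<subseteq> ground_set G}"

definition gcd_product :: "int mat \<Rightarrow> nat \<Rightarrow> nat set \<Rightarrow> nat" where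
  "gcd_product G m K = (\<Prod>l = 1..col_rank G K. gcd m (col_edivisor G l K))"

definition weight_poly :: "int mat \<Rightarrow> nat \<Rightarrow> nat \<Rightarrow> rat poly" where
  "weight_poly G m i =
     (\<Sum>J | J \<subseteq> ground_set G \<and> card J = dim_col G - i.
        \<Sum>K | J \<subseteq> K \<and> K \<subseteq> ground_set G.
          monom ((- 1) ^ (card K - card J) *
                 (of_nat (gcd_product G m K) / of_nat (gcd_product G m (ground_set G))))
                (col_rank G (ground_set G) - col_rank G K))"

text \<open>The library sets \<open>degree 0 = 0\<close>, whereas here the zero polynomial has no degree in
  the natural numbers.\<close>

definition has_degree :: "'a::zero poly \<Rightarrow> nat \<Rightarrow> bool" where
  "has_degree p d \<longleftrightarrow> p \<noteq> 0 \<and> degree p = d"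

end

theory Submission
  imports Defs
begin

text \<open>Only matroid-type properties of the column rank matter: it is monotone and grows by at
  most one when a column is added. For \<open>s \<le> r(E)\<close> let \<open>M\<close> be the largest size of a column set of
  rank at most \<open>r(E) - s\<close>; it is attained at a set of rank exactly \<open>r(E) - s\<close>. Sets larger than
  \<open>M\<close> have larger rank and so contribute only to powers below \<open>t\<^sup>s\<close>. A set \<open>J\<close> of size \<open>M\<close> has
  rank at least \<open>r(E) - s\<close>, and its proper supersets have rank above \<open>r(E) - s\<close>, so \<open>t\<^sup>s\<close> arises
  only from \<open>K = J\<close>, with positive coefficient. Hence \<open>n - M\<close> is the least index of degree \<open>s\<close>,
  and \<open>M\<close> strictly increases with the rank bound.\<close>

section \<open>Rank functions with unit increments and their polynomials\<close>

locale weighted_rank =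
  fixes E :: "'a set" and r :: "'a set \<Rightarrow> nat" and c :: "'a set \<Rightarrow> 'b::linordered_idom"
  assumes finite_ground: "finite E"
    and rank_empty: "r {} = 0"
    and rank_mono: "A \<subseteq> B \<Longrightarrow> B \<subseteq> E \<Longrightarrow> r A \<le> r B"
    and rank_insert: "A \<subseteq> E \<Longrightarrow> x \<in> E \<Longrightarrow> r (insert x A) \<le> Suc (r A)"
    and weight_pos: "K \<subseteq> E \<Longrightarrow> c K > 0"
begin

definition max_card :: "nat \<Rightarrow> nat" where
  "max_card \<rho> = Max (card ` {A. A \<subseteq> E \<and> r A \<le> \<rho>})"

text \<open>Indexed by the size of \<open>J\<close> rather than by codeword weight: weight
  \<open>i\<close> corresponds to \<open>d = card E - i\<close>, with \<open>c\<close> the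
  normalised gcd product.\<close>

definition size_poly :: "nat \<Rightarrow> 'b poly" where
  "size_poly d = (\<Sum>J | J \<subseteq> E \<and> card J = d. \<Sum>K | J \<subseteq> K \<and> K \<subseteq> E.
     monom ((- 1) ^ (card K - card J) * c K) (r E - r K))"

lemma card_le_max_card: "A \<subseteq> E \<Longrightarrow> r A \<le> \<rho> \<Longrightarrow> card A \<le> max_card \<rho>"
  unfolding max_card_def by (rule Max_ge) (use finite_ground in auto)

lemma rank_gt_if_card_gt: "A \<subseteq> E \<Longrightarrow> max_card \<rho> < card A \<Longrightarrow> \<rho> < r A"
  using card_le_max_card[of A \<rho>] by linarith

lemma max_card_le: "max_card \<rho> \<le> card E"
  unfolding max_card_def using finite_ground rank_empty
  by (subst Max_le_iff) (auto intro: card_mono)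

text \<open>Otherwise \<open>J\<close> misses some element; adding it raises the rank by at most
  one, so the bound \<rho> still holds for a larger set, against maximality.\<close>

lemma rank_ge_if_card_eq:
  assumes "J \<subseteq> E" "card J = max_card \<rho>" "\<rho> \<le> r E"
  shows "\<rho> \<le> r J"
proof (rule ccontr)
  assume low: "\<not> \<rho> \<le> r J"
  with assms obtain x where x: "x \<in> E" "x \<notin> J" by (metis subsetI subset_antisym)
  have "card (insert x J) \<le> max_card \<rho>"
    using card_le_max_card[of "insert x J" \<rho>] rank_insert[of J x] low x assms by simp
  moreover have "card (insert x J) = Suc (card J)"
    using x assms finite_ground by (meson card_insert_disjoint finite_subset)
  ultimately show False using assms by simp
qed

lemma max_card_attained:
  assumes "\<rho> \<le> r E"
  obtains A where "A \<subseteq> E" "card A = max_card \<rho>" "r A = \<rho>"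
proof -
  have "max_card \<rho> \<in> card ` {A. A \<subseteq> E \<and> r A \<le> \<rho>}"
    unfolding max_card_def using finite_ground rank_empty by (intro Max_in) auto
  then obtain A where "A \<subseteq> E" "card A = max_card \<rho>" "r A \<le> \<rho>" by auto
  with rank_ge_if_card_eq[of A \<rho>] assms that show ?thesis by (meson le_antisym)
qed

text \<open>A largest set for \<rho> has rank \<rho> < \<open>r E\<close>, hence misses an element;
  adding one stays within the bound \<open>Suc\<close> \<rho>.\<close>

lemma max_card_less_Suc:
  assumes "\<rho> < r E"
  shows "max_card \<rho> < max_card (Suc \<rho>)"
proof -
  obtain A where A: "A \<subseteq> E" "card A = max_card \<rho>" "r A = \<rho>"
    using max_card_attained assms by (metis less_imp_le)
  with assms obtain x where x: "x \<in> E" "x \<notin> A" by (metis less_irrefl subsetI subset_antisym)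
  have "card (insert x A) \<le> max_card (Suc \<rho>)"
    using A x rank_insert[of A x] by (intro card_le_max_card) auto
  moreover have "card (insert x A) = Suc (card A)"
    using x A finite_ground by (meson card_insert_disjoint finite_subset)
  ultimately show ?thesis using A by simp
qed

lemma coeff_size_poly:
  "coeff (size_poly d) k = (\<Sum>J | J \<subseteq> E \<and> card J = d. \<Sum>K | J \<subseteq> K \<and> K \<subseteq> E.
     if r E - r K = k then (- 1) ^ (card K - card J) * c K else 0)"
  by (simp only: size_poly_def coeff_sum coeff_monom)

lemma not_has_degree_size_poly:
  assumes "\<rho> \<le> r E" "max_card \<rho> < d"
  shows "\<not> has_degree (size_poly d) (r E - \<rho>)"
proof -
  have "r E - r K \<noteq> r E - \<rho>" if "J \<subseteq> K" "K \<subseteq> E" "card J = d" for J K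
  proof -
    have "card J \<le> card K" using that finite_ground by (meson card_mono finite_subset)
    then have "\<rho> < r K" using that assms rank_gt_if_card_gt[of K \<rho>] by simp
    \<comment> \<open>Subtraction is truncated, so \<open>r K\<close> \<le> \<open>r E\<close> is
      what keeps the two exponents apart when \<rho> = \<open>r E\<close>.\<close>
    then show ?thesis using rank_mono[of K E] that by simp
  qed
  then have "coeff (size_poly d) (r E - \<rho>) = 0"
    unfolding coeff_size_poly by (intro sum.neutral ballI if_not_P) blast
  then show ?thesis unfolding has_degree_def by (metis leading_coeff_0_iff)
qed

lemma has_degree_size_poly:
  assumes \<rho>: "\<rho> \<le> r E"
  shows "has_degree (size_poly (max_card \<rho>)) (r E - \<rho>)"
proof -
  let ?S = "{J. J \<subseteq> E \<and> card J = max_card \<rho>}"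
  have rank_gt: "\<rho> < r K" if "J \<in> ?S" "J \<subset> K" "K \<subseteq> E" for J K
    using that finite_ground rank_gt_if_card_gt[of K \<rho>] psubset_card_mono[of K J]
    by (auto dest: finite_subset)
  have rank_ge: "\<rho> \<le> r K" if "J \<in> ?S" "J \<subseteq> K" "K \<subseteq> E" for J K
    using that rank_ge_if_card_eq[of J \<rho>] rank_mono[of J K] \<rho> by simp
  have "coeff (size_poly (max_card \<rho>)) k = 0" if k: "r E - \<rho> < k" for k
  proof -
    have "r E - r K \<noteq> k" if "J \<in> ?S" "J \<subseteq> K" "K \<subseteq> E" for J K
      using rank_ge[OF that] k by linarith
    then show ?thesis
      unfolding coeff_size_poly by (intro sum.neutral ballI if_not_P) blast
  qed
  then have deg: "degree (size_poly (max_card \<rho>)) \<le> r E - \<rho>"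
    by (intro degree_le) auto
  \<comment> \<open>Only \<open>K = J\<close> can reach the top exponent, and there the sign is
    \<open>(- 1) ^ 0\<close>, so nothing cancels.\<close>
  have inner: "(\<Sum>K | J \<subseteq> K \<and> K \<subseteq> E. if r E - r K = r E - \<rho>
        then (- 1) ^ (card K - card J) * c K else 0) = (if r J = \<rho> then c J else 0)"
    if J: "J \<in> ?S" for J
  proof -
    have "(\<Sum>K | J \<subseteq> K \<and> K \<subseteq> E. if r E - r K = r E - \<rho>
        then (- 1) ^ (card K - card J) * c K else 0) =
      (\<Sum>K \<in> {J}. if r E - r K = r E - \<rho> then (- 1) ^ (card K - card J) * c K else 0)"
    proof (rule sum.mono_neutral_right)
      show "finite {K. J \<subseteq> K \<and> K \<subseteq> E}" using finite_ground by simp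
      show "{J} \<subseteq> {K. J \<subseteq> K \<and> K \<subseteq> E}" using J by simp
      show "\<forall>K \<in> {K. J \<subseteq> K \<and> K \<subseteq> E} - {J}.
          (if r E - r K = r E - \<rho> then (- 1) ^ (card K - card J) * c K else 0) = 0"
      proof
        fix K assume K: "K \<in> {K. J \<subseteq> K \<and> K \<subseteq> E} - {J}"
        then have "\<rho> < r K" using rank_gt[OF J, of K] by auto
        moreover have "r K \<le> r E" using K rank_mono[of K E] by auto
        ultimately show "(if r E - r K = r E - \<rho> then (- 1) ^ (card K - card J) * c K else 0) = 0"
          by auto
      qed
    qed
    moreover have "r J \<le> r E" using J rank_mono[of J E] by auto
    ultimately show ?thesis using \<rho> by auto
  qed
  obtain A where A: "A \<subseteq> E" "card A = max_card \<rho>" "r A = \<rho>"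
    using max_card_attained \<rho> by metis
  have "coeff (size_poly (max_card \<rho>)) (r E - \<rho>) = (\<Sum>J \<in> ?S. if r J = \<rho> then c J else 0)"
    unfolding coeff_size_poly by (rule sum.cong[OF refl inner])
  also have "\<dots> > 0"
    \<comment> \<open>\<open>A\<close> contributes a strictly positive term; all others are
      nonnegative.\<close>
    by (rule sum_pos2[of _ A]) (use A weight_pos finite_ground in \<open>auto intro: less_imp_le\<close>)
  finally show ?thesis
    using deg le_degree[of "size_poly (max_card \<rho>)" "r E - \<rho>"]
    unfolding has_degree_def by auto
qed

lemma Min_has_degree:
  assumes "s \<le> r E"
  shows "Min {i \<in> {0..card E}. has_degree (size_poly (card E - i)) s} = card E - max_card (r E - s)"
proof (rule Min_eqI)
  show "card E - max_card (r E - s) \<in> {i \<in> {0..card E}. has_degree (size_poly (card E - i)) s}"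
    using has_degree_size_poly[of "r E - s"] max_card_le[of "r E - s"] assms by simp
  show "card E - max_card (r E - s) \<le> i"
    if "i \<in> {i \<in> {0..card E}. has_degree (size_poly (card E - i)) s}" for i
    \<comment> \<open>A smaller \<open>i\<close> would make \<open>card E - i\<close> exceed
      \<open>max_card (r E - s)\<close>, where degree \<open>s\<close> is excluded.\<close>
    using not_has_degree_size_poly[of "r E - s" "card E - i"] that assms by force
qed simp

lemma degrees_attained:
  assumes "s \<le> r E"
  shows "\<exists>i \<in> {0..card E}. has_degree (size_poly (card E - i)) s"
  using has_degree_size_poly[of "r E - s"] max_card_le[of "r E - s"] assms
  by (intro bexI[of _ "card E - max_card (r E - s)"]) simp_all

lemma Min_has_degree_less:
  assumes "s \<in> {1..r E}"
  shows "Min {i \<in> {0..card E}. has_degree (size_poly (card E - i)) (s - 1)} <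
         Min {i \<in> {0..card E}. has_degree (size_poly (card E - i)) s}"
proof -
  have "r E - (s - 1) = Suc (r E - s)" "r E - s < r E" using assms by auto
  then have "card E - max_card (r E - (s - 1)) < card E - max_card (r E - s)"
    \<comment> \<open>The bound by \<open>card E\<close> keeps the inequality strict under truncated
      subtraction.\<close>
    using max_card_less_Suc[of "r E - s"] max_card_le[of "Suc (r E - s)"]
    by (simp add: diff_less_mono2)
  then show ?thesis
    using assms Min_has_degree[of s] Min_has_degree[of "s - 1"] by simp
qed

end

section \<open>Matrix rank as a function of the set of columns\<close>

lemma (in vec_space) exists_maximal_indpt_cols:
  obtains U where "maximal U (\<lambda>T. T \<subseteq> set (cols A) \<and> lin_indpt T)"
  using maximal_exists[of "\<lambda>T. T \<subseteq> set (cols A) \<and> lin_indpt T" "card (set (cols A))" "{}"]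
  by (meson List.finite_set card_mono empty_iff empty_subsetI finite_lin_indpt2 rev_finite_subset)

text \<open>Deleting \<open>v\<close> from a maximal independent set of columns of \<open>B\<close>
  leaves an independent set of columns of \<open>A\<close>, and costs at most one vector. Comparing
  sets makes the order and repetition of columns irrelevant.\<close>

lemma (in vec_space) rank_le_Suc_if_cols_subset_insert:
  assumes A: "A \<in> carrier_mat n nc" and B: "B \<in> carrier_mat n nc'"
    and sub: "set (cols B) \<subseteq> insert v (set (cols A))"
  shows "rank B \<le> Suc (rank A)"
proof -
  obtain U where U: "maximal U (\<lambda>T. T \<subseteq> set (cols B) \<and> lin_indpt T)"
    by (rule exists_maximal_indpt_cols)
  then have "U \<subseteq> set (cols B)" "lin_indpt U" by (auto simp: maximal_def)
  then have "lin_indpt (U - {v})" "U - {v} \<subseteq> set (cols A)"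
    using sub subset_li_is_li[of U "U - {v}"] by blast+
  then have "card (U - {v}) \<le> rank A" using rank_ge_card_indpt[OF A] by blast
  moreover have "card U \<le> Suc (card (U - {v}))"
    by (simp add: card_Diff_singleton_if split: nat_diff_split)
  ultimately show ?thesis using rank_card_indpt[OF B U] by simp
qed

lemma (in vec_space) rank_mono_cols:
  assumes A: "A \<in> carrier_mat n nc" and B: "B \<in> carrier_mat n nc'"
    and sub: "set (cols A) \<subseteq> set (cols B)"
  shows "rank A \<le> rank B"
proof -
  obtain U where U: "maximal U (\<lambda>T. T \<subseteq> set (cols A) \<and> lin_indpt T)"
    by (rule exists_maximal_indpt_cols)
  then have "U \<subseteq> set (cols B)" "lin_indpt U" using sub by (auto simp: maximal_def)
  then show ?thesis using rank_ge_card_indpt[OF B] rank_card_indpt[OF A U] by simp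
qed

section \<open>Column submatrices and the weight polynomials\<close>

lemma columns_of_carrier:
  "columns_of G J \<in> carrier_mat (dim_row G) (card {j. j < dim_col G \<and> j \<in> J})"
  by (rule carrier_matI) (simp_all add: dim_submatrix)

lemma set_cols_columns_of:
  assumes "J \<subseteq> ground_set G"
  shows "set (cols (map_mat f (columns_of G J))) = (\<lambda>j. map_vec f (col G j)) ` J"
proof -
  have J: "{j. j < dim_col G \<and> j \<in> J} = J" using assms by auto
  have fin: "finite J" using assms finite_subset by blast
  have col: "col (columns_of G J) l = col G (pick J l)"
    if l: "l < card J" for l
  proof (rule eq_vecI)
    have "pick J l < dim_col G" using pick_in_set_le[OF l] assms by auto
    then show "col (columns_of G J) l $ i = col G (pick J l) $ i"
      if "i < dim_vec (col G (pick J l))" for i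
      using that l by (simp add: dim_submatrix submatrix_index J pick_UNIV)
  qed (simp add: dim_submatrix)
  have "pick J ` {..<card J} = J"
  proof
    show "pick J ` {..<card J} \<subseteq> J" using pick_in_set_le by auto
    show "J \<subseteq> pick J ` {..<card J}"
    proof
      fix j assume j: "j \<in> J"
      \<comment> \<open>The position of \<open>j\<close> in the increasing enumeration
        \<open>pick J\<close> is the number of smaller elements of \<open>J\<close>.\<close>
      have "card {a \<in> J. a < j} < card J" using j fin by (intro psubset_card_mono) auto
      then show "j \<in> pick J ` {..<card J}" using pick_card_in_set[OF j]
        by (intro image_eqI[where x = "card {a \<in> J. a < j}"]) simp_all
    qed
  qed
  then have "(\<lambda>j. map_vec f (col G j)) ` J = (\<lambda>l. map_vec f (col G (pick J l))) ` {..<card J}"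
    by (metis image_image)
  also have "\<dots> = set (cols (map_mat f (columns_of G J)))"
    by (simp add: cols_def dim_submatrix J col atLeast0LessThan cong: image_cong_simp)
  finally show ?thesis by simp
qed

lemma col_rank_eq: "col_rank G J = vec_space.rank (dim_row G) (map_mat rat_of_int (columns_of G J))"
  by (simp add: col_rank_def int_rank_def dim_submatrix)

lemma gcd_product_pos: "m > 0 \<Longrightarrow> gcd_product G m K > 0"
  unfolding gcd_product_def by (rule prod_pos) simp

text \<open>Passing from \<open>A\<close> to \<open>insert x A\<close> adds at most the column
  \<open>x\<close> to the set of columns, which gives unit increments; the weights are positive
  because \<open>m\<close> is.\<close>

lemma weighted_rank_col_rank:
  assumes "m > 0"
  shows "weighted_rank (ground_set G) (col_rank G)
    (\<lambda>K. of_nat (gcd_product G m K) / of_nat (gcd_product G m (ground_set G)) :: rat)"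
proof -
  interpret V: vec_space "TYPE(rat)" "dim_row G" .
  let ?A = "\<lambda>J. map_mat rat_of_int (columns_of G J)"
  have carrier: "?A J \<in> carrier_mat (dim_row G) (card {j. j < dim_col G \<and> j \<in> J})" for J
    using columns_of_carrier[of G J] by simp
  show ?thesis
  proof
    show "finite (ground_set G)" by simp
    \<comment> \<open>The submatrix for the empty set has no columns, and rank is at most the number
      of columns.\<close>
    show "col_rank G {} = 0" using V.rank_le_nc[OF carrier[of "{}"]] by (simp add: col_rank_eq)
    show "col_rank G A \<le> col_rank G B" if "A \<subseteq> B" "B \<subseteq> ground_set G" for A B
      unfolding col_rank_eq using that
      by (intro V.rank_mono_cols[OF carrier carrier]) (auto simp: set_cols_columns_of)
    show "col_rank G (insert x A) \<le> Suc (col_rank G A)"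
      if "A \<subseteq> ground_set G" "x \<in> ground_set G" for A x
      unfolding col_rank_eq
      using that
      by (intro V.rank_le_Suc_if_cols_subset_insert[OF carrier carrier,
            where v = "map_vec rat_of_int (col G x)"])
        (auto simp: set_cols_columns_of)
    show "0 < rat_of_nat (gcd_product G m K) / rat_of_nat (gcd_product G m (ground_set G))" for K
      using gcd_product_pos[OF assms] by simp
  qed
qed

theorem theorem3p6:
  fixes G :: "int mat" and k n m :: nat
  assumes "G \<in> carrier_mat k n"
    and "\<forall>j<n. col G j \<noteq> 0\<^sub>v k"
    and "m \<in> {1..lcm_period G}"
  shows "(\<forall>s \<in> {0..col_rank G (ground_set G)}.
            \<exists>i \<in> {0..n}. has_degree (weight_poly G m i) s) \<and>
         (\<forall>s \<in> {1..col_rank G (ground_set G)}.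
            Min {i \<in> {0..n}. has_degree (weight_poly G m i) (s - 1)}
            < Min {i \<in> {0..n}. has_degree (weight_poly G m i) s})"
proof -
  interpret weighted_rank "ground_set G" "col_rank G"
    "\<lambda>K. of_nat (gcd_product G m K) / of_nat (gcd_product G m (ground_set G)) :: rat"
    using assms by (intro weighted_rank_col_rank) simp
  have n: "n = card (ground_set G)" using assms by simp
  have "weight_poly G m i = size_poly (card (ground_set G) - i)" for i
    by (simp add: weight_poly_def size_poly_def)
  then show ?thesis
    unfolding n using degrees_attained Min_has_degree_less by simp
qed

end
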